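(* Let $k$ be a positive integer and let $G_k$ be the graph with vertex set $A_k\cup B_k\cup C_k\cup D_k$, where $A_k=\{a_1,\ldots,a_{2k}\}$, $B_k=\{b_1,\ldots,b_{2k}\}$, $C_k=\{c_1,\ldots,c_k\}$, $D_k=\{d_1,\ldots,d_k\}$, and edge set $\{a_ib_i\mid 1\leqslant i\leqslant 2k\}\cup\{a_ic_j,\ b_id_j\mid 1\leqslant i\leqslant 2k,\ 1\leqslant j\leqslant k\}$. Then $mp(G_k)=k+1$ and $mp_f(G_k)=2$.
   Context: For a graph $G$ with an even number of vertices, the matching preclusion number $mp(G)$ is the minimum number of edges whose deletion leaves a graph with no perfect matching. Let $\mathcal{M}(G)$ be the set of perfect matchings of $G$ and $\bm{q}^M\in\mathbb{R}^{E(G)}$ the incidence vector of $M$. The fractional matching preclusion number $mp_f(G)$ is the optimal value of the linear program: minimize $\bm{1}^T\bm{y}$ over $\bm{y}\in\mathbb{R}^{E(G)}$ subject to $(\bm{q}^M)^T\bm{y}\geqslant 1$ for every $M\in\mathcal{M}(G)$ and $\bm{y}\geqslant 0$. *)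

theory Defs
  imports Complex_Main "HOL-Library.Disjoint_Sets" "HOL-Library.Indicator_Function"
begin

text \<open>A graph is a pair of a vertex set and a set of edges, each edge being a
  two-element set of vertices.\<close>

type_synonym 'a graph = "'a set \<times> 'a set set"

abbreviation verts :: "'a graph \<Rightarrow> 'a set" where "verts \<equiv> fst"
abbreviation edges :: "'a graph \<Rightarrow> 'a set set" where "edges \<equiv> snd"

definition simple_graph :: "'a graph \<Rightarrow> bool" where
  "simple_graph G \<longleftrightarrow> finite (verts G) \<and> (\<forall>e\<in>edges G. e \<subseteq> verts G \<and> card e = 2)"

definition delete_edges :: "'a graph \<Rightarrow> 'a set set \<Rightarrow> 'a graph" where
  "delete_edges G F = (verts G, edges G - F)"

definition perfect_matchings :: "'a graph \<Rightarrow> 'a set set set" where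
  "perfect_matchings G = {M. M \<subseteq> edges G \<and> disjoint M \<and> \<Union>M = verts G}"

definition mp :: "'a graph \<Rightarrow> nat" where
  "mp G = (LEAST n. \<exists>F\<subseteq>edges G. card F = n \<and> perfect_matchings (delete_edges G F) = {})"

text \<open>A vector indexed by the edge set is a function on all sets of vertices, of which only
  the values on edges matter; the incidence vector of \<open>M\<close> is \<open>indicator M\<close>.\<close>

definition mp_f_feasible :: "'a graph \<Rightarrow> ('a set \<Rightarrow> real) \<Rightarrow> bool" where
  "mp_f_feasible G y \<longleftrightarrow>
     (\<forall>M\<in>perfect_matchings G. (\<Sum>e\<in>edges G. indicator M e * y e) \<ge> 1) \<and> (\<forall>e\<in>edges G. y e \<ge> 0)"

definition mp_f :: "'a graph \<Rightarrow> real" where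
  "mp_f G = (INF y\<in>{y. mp_f_feasible G y}. \<Sum>e\<in>edges G. y e)"

datatype vertex = Va nat | Vb nat | Vc nat | Vd nat

definition Gk :: "nat \<Rightarrow> vertex graph" where
  "Gk k =
     (Va ` {1..2*k} \<union> Vb ` {1..2*k} \<union> Vc ` {1..k} \<union> Vd ` {1..k},
      {{Va i, Vb i} | i. i \<in> {1..2*k}} \<union>
      {{Va i, Vc j} | i j. i \<in> {1..2*k} \<and> j \<in> {1..k}} \<union>
      {{Vb i, Vd j} | i j. i \<in> {1..2*k} \<and> j \<in> {1..k}})"

lemma simple_graph_Gk: "simple_graph (Gk k)"
  by (auto simp: simple_graph_def Gk_def)

lemma card_verts_Gk: "card (verts (Gk k)) = 6 * k"
proof -
  have "inj_on Va S" "inj_on Vb S" "inj_on Vc S" "inj_on Vd S" for S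
    by (auto simp: inj_on_def)
  then show ?thesis
    unfolding Gk_def fst_conv
    by (subst card_Un_disjoint; (auto simp: card_image)?)+
qed

end

theory Submission imports Defs begin

text \<open>Every perfect matching of \<open>G\<^sub>k\<close> is determined by a \<open>k\<close>-subset \<open>T\<close> of the indices together with
  bijections from \<open>T\<close> onto the indices of \<open>C\<^sub>k\<close> and of \<open>D\<^sub>k\<close>; it uses exactly the \<open>k\<close> rungs
  \<open>a\<^sub>ib\<^sub>i\<close> with \<open>i \<notin> T\<close>.

  For \<open>mp\<close>: deleting the \<open>k + 1\<close> edges at \<open>a\<^sub>1\<close> destroys all perfect matchings. If only \<open>k\<close> edges are
  deleted, choose \<open>T\<close> to contain the indices of the deleted rungs and such that fewer than \<open>k\<close>
  deleted edges join \<open>A\<^sub>T\<close> to \<open>C\<^sub>k\<close>, and fewer than \<open>k\<close> join \<open>B\<^sub>T\<close> to \<open>D\<^sub>k\<close>. A complete bipartite graph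
  \<open>K\<^sub>k\<^sub>,\<^sub>k\<close> has \<open>k\<close> edge-disjoint perfect matchings, so one survives on either side.

  For \<open>mp\<^sub>f\<close>: weight \<open>1/k\<close> on each rung is feasible with value \<open>2\<close>, and two
  edge-disjoint perfect matchings show that no feasible vector has smaller value.\<close>

section \<open>Bijections avoiding fewer than \<open>k\<close> pairs\<close>

lemma bij_betw_avoiding:
  assumes "finite P" "card P < k" "finite S" "card S = k" "finite C" "card C = k"
  obtains h where "bij_betw h S C" "\<And>i. i \<in> S \<Longrightarrow> (i, h i) \<notin> P"
proof -
  obtain g where g: "bij_betw g S {0..<k}"
    using ex_bij_betw_finite_nat[OF \<open>finite S\<close>] assms by auto
  obtain g' where g': "bij_betw g' {0..<k} C"
    using ex_bij_betw_nat_finite[OF \<open>finite C\<close>] assms by auto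
  \<comment> \<open>The \<open>h s\<close> with \<open>s < k\<close> are the cyclic shifts of one
    bijection. Their graphs are pairwise disjoint, so fewer than \<open>k\<close> forbidden pairs
    cannot meet all of them.\<close>
  define h where "h s i = g' ((g i + s) mod k)" for s i
  have k: "k > 0" using assms by simp
  have "inj_on (\<lambda>x. (x + s) mod k) {0..<k}" for s
  proof (rule inj_onI)
    fix x y assume "x \<in> {0..<k}" "y \<in> {0..<k}" "(x + s) mod k = (y + s) mod k"
    \<comment> \<open>Over the integers the common summand \<open>s\<close> can be
      subtracted.\<close>
    then have "int x mod int k = int y mod int k"
      by (metis add_diff_cancel_right' mod_diff_left_eq of_nat_add zmod_int)
    then show "x = y" using \<open>x \<in> _\<close> \<open>y \<in> _\<close> by simp
  qed
  then have shift: "bij_betw (\<lambda>x. (x + s) mod k) {0..<k} {0..<k}" for s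
    using k by (intro bij_betw_imageI endo_inj_surj) auto
  have bij: "bij_betw (h s) S C" for s
    using bij_betw_trans[OF bij_betw_trans[OF g shift] g'] by (simp add: h_def[abs_def] comp_def)
  show thesis
  proof (cases "\<exists>s<k. \<forall>i\<in>S. (i, h s i) \<notin> P")
    case True
    then show thesis using bij that by blast
  next
    case False
    then obtain f where f: "f s \<in> S" "(f s, h s (f s)) \<in> P" if "s < k" for s
      by metis
    \<comment> \<open>If every shift met \<open>P\<close>, picking one forbidden pair per shift
      would inject \<open>k\<close> shifts into \<open>P\<close>: a pair \<open>(i, h s i)\<close>
      determines \<open>s\<close>.\<close>
    have "inj_on (\<lambda>s. (f s, h s (f s))) {0..<k}"
    proof (rule inj_onI)
      fix s t assume st: "s \<in> {0..<k}" "t \<in> {0..<k}" "(f s, h s (f s)) = (f t, h t (f t))"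
      then have "g' ((g (f s) + s) mod k) = g' ((g (f s) + t) mod k)"
        by (auto simp: h_def)
      then have "(g (f s) + s) mod k = (g (f s) + t) mod k"
        using bij_betw_imp_inj_on[OF g'] k by (auto dest: inj_onD)
      then have "(s + g (f s)) mod k = (t + g (f s)) mod k" by (simp add: add.commute)
      then show "s = t"
        using bij_betw_imp_inj_on[OF shift[of "g (f s)"]] st(1,2) by (auto dest: inj_onD)
    qed
    moreover have "(\<lambda>s. (f s, h s (f s))) ` {0..<k} \<subseteq> P" using f by auto
    ultimately have "card {0..<k} \<le> card P"
      using \<open>finite P\<close> by (rule card_inj_on_le)
    then show thesis using assms by simp
  qed
qed

section \<open>Perfect matchings of \<open>Gk k\<close>\<close>

definition rung :: "nat \<Rightarrow> vertex set" where
  "rung i = {Va i, Vb i}"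

definition matching_of :: "nat \<Rightarrow> nat set \<Rightarrow> (nat \<Rightarrow> nat) \<Rightarrow> (nat \<Rightarrow> nat) \<Rightarrow> vertex set set" where
  "matching_of k T h h' = rung ` ({1..2*k} - T) \<union>
     (\<lambda>i. {Va i, Vc (h i)}) ` T \<union> (\<lambda>i. {Vb i, Vd (h' i)}) ` T"

lemma edges_Gk:
  "edges (Gk k) = rung ` {1..2*k} \<union> (\<lambda>(i, j). {Va i, Vc j}) ` ({1..2*k} \<times> {1..k}) \<union>
     (\<lambda>(i, j). {Vb i, Vd j}) ` ({1..2*k} \<times> {1..k})"
  by (auto simp: Gk_def rung_def)

lemma finite_edges_Gk: "finite (edges (Gk k))"
  unfolding edges_Gk by auto

lemma inj_rung: "inj_on rung A"
  by (auto simp: inj_on_def rung_def doubleton_eq_iff)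

lemma matching_of_perfect:
  assumes T: "T \<subseteq> {1..2*k}" and h: "bij_betw h T {1..k}" and h': "bij_betw h' T {1..k}"
  shows "matching_of k T h h' \<in> perfect_matchings (Gk k)"
proof -
  have img: "h ` T = {1..k}" "h' ` T = {1..k}"
    using h h' by (auto simp: bij_betw_def)
  have inj: "h i = h j \<Longrightarrow> i = j" "h' i = h' j \<Longrightarrow> i = j" if "i \<in> T" "j \<in> T" for i j
    using that h h' by (auto simp: bij_betw_def dest: inj_onD)
  have "matching_of k T h h' \<subseteq> edges (Gk k)"
    unfolding matching_of_def edges_Gk using T img by (force simp: rung_def)
  moreover have "disjoint (matching_of k T h h')"
    unfolding matching_of_def disjoint_def rung_def by (auto dest: inj)
  moreover have "\<Union>(matching_of k T h h') =
      Va ` (({1..2*k} - T) \<union> T) \<union> Vb ` (({1..2*k} - T) \<union> T) \<union> Vc ` h ` T \<union> Vd ` h' ` T"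
    unfolding matching_of_def rung_def by auto
  moreover have "({1..2*k} - T) \<union> T = {1..2*k}" using T by blast
  ultimately show ?thesis
    using img by (simp add: perfect_matchings_def Gk_def)
qed

text \<open>A common rung would have its index outside both \<open>S\<close> and \<open>T\<close>;
  any other common edge would have its index in both.\<close>

lemma matching_of_disjoint:
  assumes "S \<inter> T = {}" "{1..2*k} \<subseteq> S \<union> T"
  shows "matching_of k S g g' \<inter> matching_of k T h h' = {}"
proof -
  have False if "e \<in> matching_of k S g g'" "e \<in> matching_of k T h h'" for e
    using that assms unfolding matching_of_def rung_def
    by (elim UnE imageE) (auto simp only: doubleton_eq_iff vertex.inject vertex.distinct)
  then show ?thesis by blast
qed

lemma perfect_matchings_delete_edges:
  "perfect_matchings (delete_edges G F) = {M \<in> perfect_matchings G. M \<inter> F = {}}"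
  by (auto simp: perfect_matchings_def delete_edges_def)

text \<open>A vertex \<open>Va i\<close> not matched along its rung takes a partner among the
  \<open>k\<close> vertices \<open>Vc j\<close>, and distinct such vertices take distinct partners.
  So at most \<open>k\<close> of the \<open>2*k\<close> rungs are missing.\<close>

lemma perfect_matching_rungs:
  assumes M: "M \<in> perfect_matchings (Gk k)"
  shows "k \<le> card {i \<in> {1..2*k}. rung i \<in> M}"
proof -
  let ?R = "{i \<in> {1..2*k}. rung i \<in> M}"
  let ?N = "{i \<in> {1..2*k}. rung i \<notin> M}"
  have sub: "M \<subseteq> edges (Gk k)" and disj: "disjoint M" and cov: "\<Union>M = verts (Gk k)"
    using M by (auto simp: perfect_matchings_def)
  have "\<exists>j\<in>{1..k}. {Va i, Vc j} \<in> M" if "i \<in> ?N" for i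
  proof -
    have "Va i \<in> \<Union>M" using that cov by (auto simp: Gk_def)
    then obtain e where e: "e \<in> M" "Va i \<in> e" by blast
    then have "e \<in> edges (Gk k)" using sub by blast
    then show ?thesis using e that unfolding edges_Gk by (auto simp: rung_def)
  qed
  then have "\<forall>i\<in>?N. \<exists>j. j \<in> {1..k} \<and> {Va i, Vc j} \<in> M" by blast
  from bchoice[OF this] obtain f
    where f: "f i \<in> {1..k}" "{Va i, Vc (f i)} \<in> M" if "i \<in> ?N" for i
    by blast
  have "inj_on f ?N"
  proof (rule inj_onI)
    fix i i' assume i: "i \<in> ?N" "i' \<in> ?N" "f i = f i'"
    then have "{Va i, Vc (f i)} = {Va i', Vc (f i')}"
      using disjointD[OF disj f(2)[OF i(1)] f(2)[OF i(2)]] by auto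
    then show "i = i'" by (auto simp: doubleton_eq_iff)
  qed
  then have "card ?N \<le> card {1..k}"
    using f(1) by (intro card_inj_on_le[of f]) auto
  moreover have "card ?R + card ?N = card (?R \<union> ?N)"
    by (intro card_Un_disjoint[symmetric]) auto
  moreover have "?R \<union> ?N = {1..2*k}" by auto
  ultimately show ?thesis by simp
qed

section \<open>The matching preclusion number\<close>

lemma mp_eqI:
  assumes "F \<subseteq> edges G" "perfect_matchings (delete_edges G F) = {}"
    and "\<And>F'. F' \<subseteq> edges G \<Longrightarrow> card F' < card F \<Longrightarrow> perfect_matchings (delete_edges G F') \<noteq> {}"
  shows "mp G = card F"
  unfolding mp_def using assms by (intro Least_equality) (auto simp: not_less[symmetric])

text \<open>\<open>I\<close> stands for the deleted rungs, \<open>P\<close> and \<open>Q\<close> for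
  the deleted edges on the two sides. Any \<open>k\<close>-set containing \<open>I\<close> will do
  unless \<open>P\<close> or \<open>Q\<close> alone exhausts the bound \<open>k\<close>.\<close>

lemma exists_index_set_avoiding:
  fixes P Q :: "(nat \<times> 'a) set"
  assumes "I \<subseteq> {1..2*k}" "finite P" "finite Q" "card I + card P + card Q \<le> k" "k \<ge> 1"
  obtains T where "I \<subseteq> T" "T \<subseteq> {1..2*k}" "card T = k"
    "card (P \<inter> T \<times> UNIV) < k" "card (Q \<inter> T \<times> UNIV) < k"
proof -
  have finI: "finite I" using assms finite_subset by blast
  \<comment> \<open>The extreme case, stated for arbitrary \<open>P\<close> and \<open>Q\<close> so
    that it also applies with the two exchanged.\<close>
  have full: "\<exists>T. I \<subseteq> T \<and> T \<subseteq> {1..2*k} \<and> card T = k \<and>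
      card (P \<inter> T \<times> UNIV) < k \<and> card (Q \<inter> T \<times> UNIV) < k"
    if "finite P" "card I + card P + card Q \<le> k" "finite Q" "card P = k"
    for P Q :: "(nat \<times> 'a) set"
  proof -
    have "I = {}" "Q = {}" using that finI by auto
    have "P \<noteq> {}" using \<open>card P = k\<close> \<open>k \<ge> 1\<close> by auto
    then obtain i j where ij: "(i, j) \<in> P" by auto
    \<comment> \<open>At least \<open>2*k - 1 \<ge> k\<close> indices differ from \<open>i\<close>,
      so \<open>T\<close> can omit \<open>i\<close> and thereby lose the pair \<open>(i, j)\<close>
      of \<open>P\<close>.\<close>
    have "k \<le> card ({1..2*k} - {i})"
      using \<open>k \<ge> 1\<close> by (cases "i \<in> {1..2*k}") (auto simp: card_Diff_singleton)
    then obtain T where T: "T \<subseteq> {1..2*k} - {i}" "card T = k"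
      by (meson obtain_subset_with_card_n)
    have "P \<inter> T \<times> UNIV \<subset> P" using ij T by auto
    then have "card (P \<inter> T \<times> UNIV) < k" using that by (metis psubset_card_mono)
    then show ?thesis using T \<open>I = {}\<close> \<open>Q = {}\<close> \<open>k \<ge> 1\<close> by auto
  qed
  consider "card P = k" | "card Q = k" | "card P < k" "card Q < k"
    using assms(4) by linarith
  then show thesis
  proof cases
    case 1 then show thesis using full[of P Q] assms that by blast
  next
    case 2 then show thesis using full[of Q P] assms that by (auto simp: ac_simps)
  next
    case 3
    have "card I \<le> k" "k \<le> card {1..2*k}" using assms by auto
    then obtain T where "I \<subseteq> T" "T \<subseteq> {1..2*k}" "card T = k"
      using exists_subset_between[of I k "{1..2*k}"] assms by auto
    moreover have "card (P \<inter> T \<times> UNIV) \<le> card P" "card (Q \<inter> T \<times> UNIV) \<le> card Q"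
      using assms by (auto intro: card_mono)
    ultimately show thesis using 3 by (intro that[of T]) auto
  qed
qed

lemma perfect_matching_survives:
  assumes F: "F \<subseteq> edges (Gk k)" and cF: "card F \<le> k" and k: "k \<ge> 1"
  shows "perfect_matchings (delete_edges (Gk k) F) \<noteq> {}"
proof -
  have finF: "finite F" using F finite_edges_Gk finite_subset by blast
  define ac where "ac = (\<lambda>(i, j). {Va i, Vc j})"
  define bd where "bd = (\<lambda>(i, j). {Vb i, Vd j})"
  define I where "I = rung -` F"
  define P where "P = ac -` F"
  define Q where "Q = bd -` F"
  have inj: "inj rung" "inj ac" "inj bd"
    by (auto simp: inj_on_def rung_def ac_def bd_def doubleton_eq_iff)
  have fin: "finite I" "finite P" "finite Q"
    unfolding I_def P_def Q_def using inj finF by (auto intro: finite_vimageI)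
  \<comment> \<open>The three edge types are disjoint and injectively indexed, so the index sets
    together count deleted edges.\<close>
  have "card I + card P + card Q = card (rung ` I) + card (ac ` P) + card (bd ` Q)"
    using inj by (simp add: card_image inj_on_subset)
  also have "\<dots> = card (rung ` I \<union> ac ` P \<union> bd ` Q)"
    using fin by (subst card_Un_disjoint; (subst card_Un_disjoint)?)
      (auto simp: rung_def ac_def bd_def doubleton_eq_iff)
  also have "\<dots> \<le> card F"
    using finF by (intro card_mono) (auto simp: I_def P_def Q_def)
  finally have sum: "card I + card P + card Q \<le> k" using cF by simp
  have "I \<subseteq> {1..2*k}"
    using F unfolding I_def edges_Gk by (auto simp: rung_def doubleton_eq_iff)
  then obtain T where T: "I \<subseteq> T" "T \<subseteq> {1..2*k}" "card T = k"
    "card (P \<inter> T \<times> UNIV) < k" "card (Q \<inter> T \<times> UNIV) < k"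
    using exists_index_set_avoiding[OF _ fin(2,3) sum k] by blast
  have finT: "finite T" using T finite_subset by blast
  obtain h where h: "bij_betw h T {1..k}" "\<And>i. i \<in> T \<Longrightarrow> (i, h i) \<notin> P \<inter> T \<times> UNIV"
    using bij_betw_avoiding[of "P \<inter> T \<times> UNIV" k T "{1..k}"] fin T finT by auto
  obtain h' where h': "bij_betw h' T {1..k}" "\<And>i. i \<in> T \<Longrightarrow> (i, h' i) \<notin> Q \<inter> T \<times> UNIV"
    using bij_betw_avoiding[of "Q \<inter> T \<times> UNIV" k T "{1..k}"] fin T finT by auto
  \<comment> \<open>Deleted rungs have their indices in \<open>T\<close>, whereas the matching uses
    only rungs outside \<open>T\<close>.\<close>
  have "matching_of k T h h' \<inter> F = {}"
    using T(1) h(2) h'(2) by (auto simp: matching_of_def I_def P_def Q_def ac_def bd_def)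
  then show ?thesis
    using matching_of_perfect[OF T(2) h(1) h'(1)] by (auto simp: perfect_matchings_delete_edges)
qed

lemma mp_Gk:
  assumes "k \<ge> 1"
  shows "mp (Gk k) = k + 1"
proof -
  \<comment> \<open>All edges at \<open>Va 1\<close>, which every perfect matching has to
    cover.\<close>
  define F where "F = insert (rung 1) ((\<lambda>j. {Va 1, Vc j}) ` {1..k})"
  have "inj_on (\<lambda>j. {Va 1, Vc j}) {1..k}" by (auto simp: inj_on_def doubleton_eq_iff)
  moreover have "rung 1 \<notin> (\<lambda>j. {Va 1, Vc j}) ` {1..k}"
    by (auto simp: rung_def doubleton_eq_iff)
  ultimately have cF: "card F = k + 1" by (simp add: F_def card_image)
  have "M \<inter> F \<noteq> {}" if M: "M \<in> perfect_matchings (Gk k)" for M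
  proof -
    have "Va 1 \<in> \<Union>M" using M assms by (auto simp: perfect_matchings_def Gk_def)
    then obtain e where e: "e \<in> M" "Va 1 \<in> e" by blast
    then have "e \<in> edges (Gk k)" using M by (auto simp: perfect_matchings_def)
    then have "e \<in> F" using e(2) unfolding edges_Gk F_def by (auto simp: rung_def)
    then show ?thesis using e by blast
  qed
  then have "perfect_matchings (delete_edges (Gk k) F) = {}"
    by (auto simp: perfect_matchings_delete_edges)
  moreover have "F \<subseteq> edges (Gk k)"
    using assms unfolding F_def edges_Gk by force
  ultimately show ?thesis
    using mp_eqI[of F "Gk k"] perfect_matching_survives[of _ k] assms cF by auto
qed

section \<open>The fractional matching preclusion number\<close>

lemma sum_indicator:
  assumes "finite A"
  shows "(\<Sum>x\<in>A. indicator B x :: real) = card (A \<inter> B)"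
  using sum_mult_indicator[OF assms, of "\<lambda>_. 1 :: real" B] by simp

lemma feasible_sum_matching:
  assumes "mp_f_feasible G y" "M \<in> perfect_matchings G" "finite (edges G)"
  shows "(\<Sum>e\<in>M. y e) \<ge> 1"
proof -
  have "M \<subseteq> edges G" using assms by (auto simp: perfect_matchings_def)
  then have "(\<Sum>e\<in>edges G. indicator M e * y e) = (\<Sum>e\<in>M. y e)"
    using assms(3) by (simp add: Int_absorb1)
  then show ?thesis using assms by (auto simp: mp_f_feasible_def)
qed

lemma feasible_ge_2:
  assumes "mp_f_feasible (Gk k) y"
  shows "(\<Sum>e\<in>edges (Gk k). y e) \<ge> 2"
proof -
  \<comment> \<open>The two index sets are complementary halves of \<open>{1..2*k}\<close>, which
    makes \<open>M\<close> and \<open>N\<close> edge-disjoint.\<close>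
  define M where "M = matching_of k {1..k} id id"
  define N where "N = matching_of k {k+1..2*k} (\<lambda>i. i - k) (\<lambda>i. i - k)"
  have "bij_betw (\<lambda>i. i - k) {k+1..2*k} {1..k}"
    by (rule bij_betw_byWitness[where f' = "\<lambda>i. i + k"]) auto
  then have MN: "M \<in> perfect_matchings (Gk k)" "N \<in> perfect_matchings (Gk k)"
    unfolding M_def N_def by (auto intro!: matching_of_perfect)
  have sub: "M \<union> N \<subseteq> edges (Gk k)" using MN by (auto simp: perfect_matchings_def)
  have "M \<inter> N = {}"
    unfolding M_def N_def by (rule matching_of_disjoint) auto
  then have "(\<Sum>e\<in>M \<union> N. y e) = (\<Sum>e\<in>M. y e) + (\<Sum>e\<in>N. y e)"
    using sub finite_edges_Gk by (intro sum.union_disjoint) (auto intro: finite_subset)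
  moreover have "(\<Sum>e\<in>M. y e) \<ge> 1" "(\<Sum>e\<in>N. y e) \<ge> 1"
    using feasible_sum_matching[OF assms _ finite_edges_Gk] MN by auto
  \<comment> \<open>Edges outside \<open>M \<union> N\<close> have nonnegative weight.\<close>
  moreover have "(\<Sum>e\<in>M \<union> N. y e) \<le> (\<Sum>e\<in>edges (Gk k). y e)"
    using assms sub finite_edges_Gk by (intro sum_mono2) (auto simp: mp_f_feasible_def)
  ultimately show ?thesis by linarith
qed

lemma mp_f_Gk:
  assumes "k \<ge> 1"
  shows "mp_f (Gk k) = 2"
proof -
  define R where "R = rung ` {1..2*k}"
  \<comment> \<open>Each perfect matching has at least \<open>k\<close> rungs, so weight
    \<open>1/k\<close> per rung gives it at least 1; all \<open>2*k\<close> rungs together weigh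
    2.\<close>
  define y :: "vertex set \<Rightarrow> real" where "y e = indicator R e / k" for e
  have R: "R \<subseteq> edges (Gk k)" by (auto simp: R_def edges_Gk)
  have "(\<Sum>e\<in>edges (Gk k). indicator M e * y e) \<ge> 1" if M: "M \<in> perfect_matchings (Gk k)" for M
  proof -
    have "(\<Sum>e\<in>edges (Gk k). indicator M e * y e) =
        (\<Sum>e\<in>edges (Gk k). indicator (M \<inter> R) e) / k"
      by (simp add: y_def indicator_inter_arith sum_divide_distrib)
    also have "\<dots> = card (M \<inter> R) / k"
      using R finite_edges_Gk by (simp add: sum_indicator Int_absorb1 le_infI2)
    also have "M \<inter> R = rung ` {i \<in> {1..2*k}. rung i \<in> M}"
      by (auto simp: R_def)
    finally show ?thesis
      using perfect_matching_rungs[OF M] assms by (simp add: card_image[OF inj_rung])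
  qed
  then have feas: "mp_f_feasible (Gk k) y"
    by (auto simp: mp_f_feasible_def y_def)
  have "(\<Sum>e\<in>edges (Gk k). y e) = card R / k"
    using R finite_edges_Gk
    by (simp add: y_def sum_divide_distrib[symmetric] sum_indicator Int_absorb1)
  also have "\<dots> = 2" using assms by (simp add: R_def card_image[OF inj_rung])
  finally have val: "(\<Sum>e\<in>edges (Gk k). y e) = 2" .
  show ?thesis
    unfolding mp_f_def
  \<comment> \<open>An infimum of reals needs a nonempty set bounded below: \<open>y\<close> is a
    member, and \<open>feasible_ge_2\<close> gives the bound.\<close>
  proof (rule antisym)
    show "(INF y\<in>{y. mp_f_feasible (Gk k) y}. \<Sum>e\<in>edges (Gk k). y e) \<le> 2"
      using feas val feasible_ge_2 by (intro cINF_lower2[of _ _ y] bdd_belowI2[of _ 2]) auto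
    show "2 \<le> (INF y\<in>{y. mp_f_feasible (Gk k) y}. \<Sum>e\<in>edges (Gk k). y e)"
      using feas feasible_ge_2 by (intro cINF_greatest) auto
  qed
qed

theorem theorem3p13:
  fixes k :: nat
  assumes "k \<ge> 1"
  shows "mp (Gk k) = k + 1 \<and> mp_f (Gk k) = 2"
  using mp_Gk mp_f_Gk assms by blast

end
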